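(* Let $c\in\mathbb{R}$, $a>0$ and $f\in H^2_c(\mathbb{H}_a)$. Then $$\|R_{\pi T}f(\cdot,0)\|_{X^\infty_c}=\mathcal{O}(e^{-a\pi T})\qquad(T\to+\infty),$$ where, for $T>0$ and $g:=f(\cdot,0)$, $R_{\pi T}g$ is the remainder of the exponential sampling series, $$(R_{\pi T}g)(x):=g(x)-\sum_{k\in\mathbb{Z}}g(e^{k/T})\,\mathrm{lin}_{c/T}(e^{-k}x^T)\qquad(x>0).$$
   Context: $\mathbb{R}^+=\,]0,\infty[$, $\mathbb{H}:=\{(r,\theta): r\in\mathbb{R}^+,\ \theta\in\mathbb{R}\}$, and for $a>0$, $\mathbb{H}_a:=\{(r,\theta)\in\mathbb{H}:\theta\in\,]-a,a[\,\}$. For $c\in\mathbb{R}$, $X^2_c$ is the space of measurable $\varphi:\mathbb{R}^+\to\mathbb{C}$ with $\|\varphi\|_{X^2_c}:=\left(\int_0^\infty|\varphi(r)|^2r^{2c-1}\,dr\right)^{1/2}<\infty$, and $\|\varphi\|_{X^\infty_c}:=\sup_{x>0}x^c|\varphi(x)|$. Polar-analytic: a function $f:\mathcal{D}\to\mathbb{C}$ on a domain $\mathcal{D}\subset\mathbb{H}$ is polar-analytic on $\mathcal{D}$ if for every $(r_0,\theta_0)\in\mathcal{D}$ the limit $$\lim_{(r,\theta)\to(r_0,\theta_0)}\frac{f(r,\theta)-f(r_0,\theta_0)}{re^{i\theta}-r_0e^{i\theta_0}}$$ exists in $\mathbb{C}$, independently of how $(r,\theta)$ approaches $(r_0,\theta_0)$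 within $\mathcal{D}$. Mellin--Hardy space: $H^2_c(\mathbb{H}_a)$ is the set of all functions $f:\mathbb{H}_a\to\mathbb{C}$ such that (i) $f$ is polar-analytic on $\mathbb{H}_a$; (ii) $f(\cdot,\theta)\in X^2_c$ for each $\theta\in\,]-a,a[$; (iii) $$\sup_{0<\theta<a}\left(\frac{\|f(\cdot,\theta)\|^2_{X^2_c}+\|f(\cdot,-\theta)\|^2_{X^2_c}}{2}\right)^{1/2}<+\infty.$$ For $b\in\mathbb{R}$, $\mathrm{lin}_b(x):=x^{-b}\,\mathrm{sinc}(\log x)$ for $x>0$, where $\mathrm{sinc}(t):=\frac{\sin(\pi t)}{\pi t}$ for $t\ne0$ and $\mathrm{sinc}(0):=1$. For $f\in H^2_c(\mathbb{H}_a)$ the series defining $R_{\pi T}f(\cdot,0)$ converges absolutely. *)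

theory Defs
  imports "HOL-Analysis.Analysis" "HOL-Library.Landau_Symbols"
begin

text \<open>
  A pair \<open>(r, \<theta>)\<close> is a polar coordinate, with \<open>\<theta>\<close> not reduced modulo \<open>2\<pi>\<close>: \<open>polar_halfplane\<close> is
  the Riemann surface of the logarithm. Functions on a subset of it are total HOL functions, of
  which only the values on that subset are ever used.
\<close>

definition polar_halfplane :: "(real \<times> real) set" where
  "polar_halfplane = {0<..} \<times> UNIV"

definition polar_strip :: "real \<Rightarrow> (real \<times> real) set" where
  "polar_strip a = {p \<in> polar_halfplane. snd p \<in> {-a<..<a}}"

definition polar_point :: "real \<times> real \<Rightarrow> complex" where
  "polar_point p = complex_of_real (fst p) * exp (\<i> * complex_of_real (snd p))"

text \<open>
  Intended for open connected \<open>D \<subseteq> polar_halfplane\<close>. On \<open>polar_halfplane\<close>, \<open>polar_point\<close> is locally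
  injective, so close to \<open>p0\<close> the denominator vanishes only at \<open>p0\<close> itself, which the punctured
  limit ignores.
\<close>

definition polar_analytic_on :: "(real \<times> real \<Rightarrow> complex) \<Rightarrow> (real \<times> real) set \<Rightarrow> bool"
    (infixl "polar'_analytic'_on" 50) where
  "f polar_analytic_on D \<longleftrightarrow>
     (\<forall>p0\<in>D. \<exists>L. ((\<lambda>p. (f p - f p0) / (polar_point p - polar_point p0)) \<longlongrightarrow> L) (at p0 within D))"

text \<open>
  For measurable \<open>\<phi>\<close> the integrand is nonnegative and measurable, so that \<open>integrable\<close> says exactly
  that its integral is finite. \<open>X2_norm\<close> is meaningful only on \<open>X2_space\<close>.
\<close>

definition X2_space :: "real \<Rightarrow> (real \<Rightarrow> complex) set" where
  "X2_space c = {\<phi>. \<phi> \<in> borel_measurable (lebesgue_on {0<..}) \<and>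
     integrable (lebesgue_on {0<..}) (\<lambda>r. (cmod (\<phi> r))\<^sup>2 * r powr (2 * c - 1))}"

definition X2_norm :: "real \<Rightarrow> (real \<Rightarrow> complex) \<Rightarrow> real" where
  "X2_norm c \<phi> = sqrt (LINT r|lebesgue_on {0<..}. (cmod (\<phi> r))\<^sup>2 * r powr (2 * c - 1))"

text \<open>Extended-valued, so that an infinite supremum is represented as such.\<close>

definition Xinf_norm :: "real \<Rightarrow> (real \<Rightarrow> complex) \<Rightarrow> ennreal" where
  "Xinf_norm c \<phi> = (SUP x\<in>{0<..}. ennreal (x powr c * cmod (\<phi> x)))"

definition mellin_hardy2 :: "real \<Rightarrow> real \<Rightarrow> (real \<times> real \<Rightarrow> complex) set" where
  "mellin_hardy2 c a = {f.
     f polar_analytic_on polar_strip a \<and>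
     (\<forall>\<theta>\<in>{-a<..<a}. (\<lambda>r. f (r, \<theta>)) \<in> X2_space c) \<and>
     bdd_above ((\<lambda>\<theta>. sqrt (((X2_norm c (\<lambda>r. f (r, \<theta>)))\<^sup>2 + (X2_norm c (\<lambda>r. f (r, -\<theta>)))\<^sup>2) / 2))
       ` {0<..<a})}"

text \<open>Normalized, unlike the \<open>sinc\<close> of \<open>HOL-Probability\<close>.\<close>

definition nsinc :: "real \<Rightarrow> real" where
  "nsinc t = (if t = 0 then 1 else sin (pi * t) / (pi * t))"

definition lin :: "real \<Rightarrow> real \<Rightarrow> real" where
  "lin b x = x powr (-b) * nsinc (ln x)"

definition exp_sampling_series :: "real \<Rightarrow> real \<Rightarrow> (real \<Rightarrow> complex) \<Rightarrow> real \<Rightarrow> complex" where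
  "exp_sampling_series c T g x =
     (\<Sum>\<^sub>\<infinity>k::int. g (exp (of_int k / T)) * complex_of_real (lin (c / T) (exp (- of_int k) * x powr T)))"

text \<open>\<open>exp_sampling_remainder c T g\<close> is the remainder \<open>R g\<close> with index \<open>\<pi>T\<close>.\<close>

definition exp_sampling_remainder :: "real \<Rightarrow> real \<Rightarrow> (real \<Rightarrow> complex) \<Rightarrow> real \<Rightarrow> complex" where
  "exp_sampling_remainder c T g x = g x - exp_sampling_series c T g x"

end

theory Submission
  imports Defs "HOL-Complex_Analysis.Complex_Analysis"
begin

text \<open>
  With \<open>F z = exp (c z) f (exp (Re z), Im z)\<close>, a function holomorphic on the strip \<open>\<bar>Im z\<bar> < a\<close> and
  bounded in \<open>L\<^sup>2\<close> uniformly over horizontal lines, and \<open>t = ln x\<close>, the weighted remainder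
  \<open>x powr c * R(x)\<close> is \<open>F t - (\<Sum>k. F (k/T) * nsinc (T t - k))\<close>. By the residue theorem this is
  \<open>sin (\<pi> T t) / (2 \<pi> \<i>)\<close> times the integral of \<open>F z / ((z - t) sin (\<pi> T z))\<close> along the lines
  \<open>Im z = \<plusminus>b\<close> for any \<open>b < a\<close>, and there \<open>\<bar>sin (\<pi> T z)\<bar> \<ge> sinh (\<pi> T b)\<close>. Letting \<open>b\<close> tend to \<open>a\<close>
  gives the rate \<open>exp (- a \<pi> T)\<close>.
\<close>

subsection \<open>Residue sums over rectangles\<close>

text \<open>No boundary values of \<open>F\<close> at |Im z| = a are available, so the estimate at b
  < a must have a constant that survives b -> a. On the two lines, 2 |F z| / |z - t| is at most |F
  z|^2 + 1 / |z - t|^2, and the integrals of these terms are bounded by \<open>M\<close> and pi / b,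
  whatever the length of the line and whatever t. A sup bound for \<open>F\<close> is at hand only
  on |Im z| <= b, with a constant depending on b. It is used on the vertical sides alone, where it
  carries a factor that tends to 0 as the rectangle widens; so the limit in the width comes first,
  and b -> a second. The vertical sides run midway between sample points, where |sin (pi T z)| >= 1.
  The series is an unordered \<open>infsum\<close>, which is 0 by default if the terms are not
  summable. The limit of the symmetric partial sums therefore identifies it only once summability is
  known, and that takes a separate residue argument for the squares of the samples.\<close>

lemma contour_integral_horizontal_bound:
  assumes uv: "u < v"
    and cont: "continuous_on (closed_segment (Complex u y) (Complex v y)) \<phi>"
    and bound: "\<And>x. x \<in> {u..v} \<Longrightarrow> cmod (\<phi> (Complex x y)) \<le> w x"
    and w: "w integrable_on {u..v}"
  shows "cmod (contour_integral (linepath (Complex u y) (Complex v y)) \<phi>) \<le> integral {u..v} w"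
proof -
  \<comment> \<open>Translation by \<open>Complex 0 y\<close> brings the segment to the real axis,
    where the contour integral is an ordinary integral over \<open>{u..v}\<close>.\<close>
  have path: "linepath (Complex u y) (Complex v y) =
      (+) (Complex 0 y) \<circ> linepath (of_real u) (of_real v)"
    by (auto simp: linepath_def fun_eq_iff complex_eq_iff algebra_simps)
  have "continuous_on {u..v} (\<lambda>x. \<phi> (Complex x y))"
    by (rule continuous_on_compose2[OF cont])
       (auto simp: closed_segment_same_Im closed_segment_eq_real_ivl Complex_eq
             intro!: continuous_intros)
  then have int: "(\<lambda>x. \<phi> (Complex x y)) integrable_on {u..v}"
    by (rule integrable_continuous_real)
  have *: "complex_of_real x + Complex 0 y = Complex x y" for x
    by (simp add: complex_eq_iff)
  have "contour_integral (linepath (Complex u y) (Complex v y)) \<phi> =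
      integral {u..v} (\<lambda>x. \<phi> (Complex x y))"
    using uv unfolding path contour_integral_translate
    by (subst contour_integral_linepath_Reals_eq) (auto simp: *)
  also have "cmod \<dots> \<le> integral {u..v} w"
    by (rule integral_norm_bound_integral[OF int w bound])
  finally show ?thesis .
qed

text \<open>Each horizontal side contributes at most the integral of \<open>w\<close>, each vertical
  side at most 2 b V, and the residue theorem divides the total by 2 pi. A weight \<open>w\<close>
  rather than a sup bound on the horizontal sides keeps the estimate from growing with
  \<open>L\<close>. The margins \<open>L < L'\<close> and \<open>b < a\<close> provide an open set
  around the closed rectangle.\<close>

lemma residue_sum_rectangle_bound:
  assumes b: "0 < b" "b < a" and L: "0 < L" "L < L'" and V: "0 \<le> V"
    and P: "finite P" "P \<subseteq> {z. \<bar>Re z\<bar> < L \<and> \<bar>Im z\<bar> < b}"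
    and holo: "\<phi> holomorphic_on {z. \<bar>Re z\<bar> < L' \<and> \<bar>Im z\<bar> < a} - P"
    and vert: "\<And>z. \<bar>Re z\<bar> = L \<Longrightarrow> \<bar>Im z\<bar> \<le> b \<Longrightarrow> cmod (\<phi> z) \<le> V"
    and hor: "\<And>x y. x \<in> {-L..L} \<Longrightarrow> \<bar>y\<bar> = b \<Longrightarrow> cmod (\<phi> (Complex x y)) \<le> w x"
    and w: "w integrable_on {-L..L}"
  shows "cmod (\<Sum>p\<in>P. residue \<phi> p) \<le> (integral {-L..L} w + 2 * b * V) / pi"
proof -
  define S where "S = {z. \<bar>Re z\<bar> < L' \<and> \<bar>Im z\<bar> < a}"
  define a1 a2 a3 a4 where a_def: "a1 = Complex (-L) (-b)" "a2 = Complex L (-b)"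
    "a3 = Complex L b" "a4 = Complex (-L) b"
  have S: "S = box (Complex (-L') (-a)) (Complex L' a)"
    by (auto simp: S_def in_box_complex_iff)
  have img: "path_image (rectpath a1 a3) \<subseteq> S - P"
    using b L P(2) by (auto simp: path_image_rectpath a_def S_def)
  have "contour_integral (rectpath a1 a3) \<phi> =
      2 * pi * \<i> * (\<Sum>p\<in>P. winding_number (rectpath a1 a3) p * residue \<phi> p)"
  proof (rule Residue_theorem)
    show "open S" "connected S"
      unfolding S by (auto intro: convex_connected convex_box)
    show "\<forall>z. z \<notin> S \<longrightarrow> winding_number (rectpath a1 a3) z = 0"
      using b L by (auto intro!: winding_number_rectpath_outside simp: in_cbox_complex_iff S_def a_def)
  qed (use P holo img in \<open>auto simp: S_def\<close>)
  also have "(\<Sum>p\<in>P. winding_number (rectpath a1 a3) p * residue \<phi> p) = (\<Sum>p\<in>P. residue \<phi> p)"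
  proof (intro sum.cong refl)
    fix p assume "p \<in> P"
    then have "p \<in> box a1 a3"
      using P(2) by (auto simp: in_box_complex_iff a_def)
    then show "winding_number (rectpath a1 a3) p * residue \<phi> p = residue \<phi> p"
      by (simp add: winding_number_rectpath)
  qed
  finally have eq: "contour_integral (rectpath a1 a3) \<phi> = 2 * pi * \<i> * (\<Sum>p\<in>P. residue \<phi> p)" .
  have segs: "closed_segment a1 a2 \<subseteq> S - P" "closed_segment a2 a3 \<subseteq> S - P"
    "closed_segment a3 a4 \<subseteq> S - P" "closed_segment a4 a1 \<subseteq> S - P"
    using img by (auto simp: rectpath_def Let_def path_image_join a_def)
  have cont: "continuous_on (S - P) \<phi>"
    using holo holomorphic_on_imp_continuous_on by (auto simp: S_def)
  note conts = segs[THEN continuous_on_subset[OF cont]]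
  note ints = conts[THEN contour_integrable_continuous_linepath]
  have split: "contour_integral (rectpath a1 a3) \<phi> =
      contour_integral (linepath a1 a2) \<phi> + (contour_integral (linepath a2 a3) \<phi> +
      (contour_integral (linepath a3 a4) \<phi> + contour_integral (linepath a4 a1) \<phi>))"
    using ints by (simp add: rectpath_def Let_def contour_integrable_joinI flip: a_def)
      (simp add: a_def contour_integrable_joinI)
  have h1: "cmod (contour_integral (linepath a1 a2) \<phi>) \<le> integral {-L..L} w"
    unfolding a_def using L hor b conts(1)
    by (intro contour_integral_horizontal_bound w) (auto simp: a_def)
  have h2: "cmod (contour_integral (linepath a4 a3) \<phi>) \<le> integral {-L..L} w"
    unfolding a_def using L hor b conts(3)
    by (intro contour_integral_horizontal_bound w) (auto simp: a_def closed_segment_commute)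
  have "contour_integral (linepath a3 a4) \<phi> = - contour_integral (linepath a4 a3) \<phi>"
    by (rule contour_integral_reverse_linepath) (use conts in \<open>simp add: closed_segment_commute\<close>)
  then have h3: "cmod (contour_integral (linepath a3 a4) \<phi>) \<le> integral {-L..L} w"
    using h2 by simp
  have v1: "cmod (contour_integral (linepath a2 a3) \<phi>) \<le> V * cmod (a3 - a2)"
    using L b V ints(2)
    by (intro contour_integral_bound_linepath vert)
       (auto simp: a_def closed_segment_same_Re closed_segment_eq_real_ivl)
  have v2: "cmod (contour_integral (linepath a4 a1) \<phi>) \<le> V * cmod (a1 - a4)"
    using L b V ints(4)
    by (intro contour_integral_bound_linepath vert)
       (auto simp: a_def closed_segment_same_Re closed_segment_eq_real_ivl)
  have n: "cmod (a3 - a2) = 2 * b" "cmod (a1 - a4) = 2 * b"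
    using b by (simp_all add: a_def cmod_def real_sqrt_mult)
  have "2 * pi * cmod (\<Sum>p\<in>P. residue \<phi> p) = cmod (contour_integral (rectpath a1 a3) \<phi>)"
    by (simp add: eq norm_mult)
  also have "\<dots> \<le> 2 * (integral {-L..L} w + 2 * b * V)"
    unfolding split
    using h1 h3 v1 v2 n
      norm_triangle_ineq[of "contour_integral (linepath a1 a2) \<phi>" "contour_integral (linepath a2 a3) \<phi> +
      (contour_integral (linepath a3 a4) \<phi> + contour_integral (linepath a4 a1) \<phi>)"]
      norm_triangle_ineq[of "contour_integral (linepath a2 a3) \<phi>"
      "contour_integral (linepath a3 a4) \<phi> + contour_integral (linepath a4 a1) \<phi>"]
      norm_triangle_ineq[of "contour_integral (linepath a3 a4) \<phi>" "contour_integral (linepath a4 a1) \<phi>"]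
    by (simp add: mult.commute)
  finally show ?thesis
    by (simp add: field_simps)
qed

section \<open>Zeros, size and residues of the complex sine\<close>

lemma residue_divide_simple_zero:
  assumes "open s" "z \<in> s" "f holomorphic_on s" "g holomorphic_on s"
    and g: "(g has_field_derivative g') (at z)" "g z = 0" "g' \<noteq> 0"
    and "\<And>w. w \<in> s - {z} \<Longrightarrow> g w \<noteq> 0"
  shows "residue (\<lambda>w. f w / g w) z = f z / g'"
proof (rule residue_simple')
  show "(\<lambda>w. f w / g w) holomorphic_on s - {z}"
    using assms by (intro holomorphic_intros) (auto intro: holomorphic_on_subset)
  have "((\<lambda>w. f w / ((g w - g z) / (w - z))) \<longlongrightarrow> f z / g') (at z)"
    using assms
    by (intro tendsto_divide has_field_derivativeD)
       (auto simp: continuous_on_eq_continuous_at isContD dest!: holomorphic_on_imp_continuous_on)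
  then show "((\<lambda>w. f w / g w * (w - z)) \<longlongrightarrow> f z / g') (at z)"
    by (simp add: g(2))
qed fact+

lemma sin_pi_mult_eq_0_iff:
  fixes z :: complex
  assumes "T > 0"
  shows "sin (of_real (pi * T) * z) = 0 \<longleftrightarrow> (\<exists>k::int. z = of_real (of_int k / T))"
proof -
  have "of_real (pi * T) * z = complex_of_real (of_int k * pi) \<longleftrightarrow> z = of_real (of_int k / T)" for k
    using assms by (auto simp: field_simps)
  then show ?thesis
    unfolding sin_eq_0 by simp
qed

text \<open>From sin (x + i y) = sin x cosh y + i cos x sinh y and cosh^2 = 1 + sinh^2. In this form
  the first term yields the lower bound on vertical lines and the second the one on horizontal
  lines.\<close>

lemma cmod_sin_squared: "(cmod (sin z))\<^sup>2 = (sin (Re z))\<^sup>2 + (sinh (Im z))\<^sup>2"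
proof -
  have "(cmod (sin z))\<^sup>2 = (sin (Re z))\<^sup>2 * (cosh (Im z))\<^sup>2 + (cos (Re z))\<^sup>2 * (sinh (Im z))\<^sup>2"
    by (simp add: cmod_power2 Re_sin Im_sin cosh_field_def sinh_field_def power_mult_distrib power_divide)
  then show ?thesis
    by (simp add: cosh_square_eq cos_squared_eq algebra_simps)
qed

lemma cmod_cos_squared: "(cmod (cos z))\<^sup>2 = (cos (Re z))\<^sup>2 + (sinh (Im z))\<^sup>2"
proof -
  \<comment> \<open>\<open>Im_cos\<close> produces exp (-y) - exp y, the opposite sign to that in
    sinh; squaring removes it.\<close>
  have "(exp (- Im z) - exp (Im z))\<^sup>2 = (exp (Im z) - exp (- Im z))\<^sup>2"
    by (rule power2_commute)
  then have "(cmod (cos z))\<^sup>2 = (cos (Re z))\<^sup>2 * (cosh (Im z))\<^sup>2 + (sin (Re z))\<^sup>2 * (sinh (Im z))\<^sup>2"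
    by (simp add: cmod_power2 Re_cos Im_cos cosh_field_def sinh_field_def power_mult_distrib power_divide)
  then show ?thesis
    by (simp add: cosh_square_eq sin_squared_eq algebra_simps)
qed

lemma sinh_le_cmod_sin: "\<bar>sinh (Im z)\<bar> \<le> cmod (sin z)"
  by (rule power2_le_imp_le) (simp_all add: cmod_sin_squared)

text \<open>Here pi T Re z is an odd multiple of pi / 2, so the real cosine vanishes: |sin|^2
  becomes 1 + sinh^2 and |cos|^2 becomes sinh^2.\<close>

lemma half_integer_line:
  assumes "T > 0" "\<bar>Re z\<bar> = (of_nat N + 1/2) / T"
  shows "1 \<le> cmod (sin (of_real (pi * T) * z))"
    and "cmod (cos (of_real (pi * T) * z)) \<le> cmod (sin (of_real (pi * T) * z))"
proof -
  have "cos (\<bar>pi * T * Re z\<bar>) = cos (pi * (of_nat N + 1/2))"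
    using assms by (simp add: abs_mult)
  also have "\<dots> = 0"
    by (simp add: distrib_left cos_add)
  finally have c: "cos (pi * T * Re z) = 0" by simp
  then have s: "(sin (pi * T * Re z))\<^sup>2 = 1"
    by (simp add: sin_squared_eq)
  show "1 \<le> cmod (sin (of_real (pi * T) * z))"
    by (rule power2_le_imp_le) (use s in \<open>simp_all add: cmod_sin_squared mult_ac\<close>)
  show "cmod (cos (of_real (pi * T) * z)) \<le> cmod (sin (of_real (pi * T) * z))"
    by (rule power2_le_imp_le) (use c s in \<open>simp_all add: cmod_sin_squared cmod_cos_squared mult_ac\<close>)
qed

lemma residue_over_sin_pi:
  fixes k :: int
  assumes T: "T > 0" and "open s" "of_real (of_int k / T) \<in> s" "G holomorphic_on s"
  shows "residue (\<lambda>z. G z / sin (of_real (pi * T) * z)) (of_real (of_int k / T)) =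
    G (of_real (of_int k / T)) / ((if even k then 1 else -1) * of_real (pi * T))"
proof (rule residue_divide_simple_zero)
  let ?z = "complex_of_real (of_int k / T)"
  \<comment> \<open>Zeros of the sine are spaced by 1 / T, so this ball contains just one of
    them.\<close>
  let ?s = "s \<inter> ball ?z (1 / T)"
  have z: "of_real (pi * T) * ?z = of_real (pi * of_int k)"
    using T by simp
  show "((\<lambda>z. sin (of_real (pi * T) * z)) has_field_derivative
      (if even k then 1 else -1) * of_real (pi * T)) (at ?z)"
    by (rule derivative_eq_intros refl | simp only: z cos_of_real cos_npi_int)+ simp
  show "sin (of_real (pi * T) * ?z) = 0"
    unfolding z sin_of_real by simp
  show "sin (of_real (pi * T) * w) \<noteq> 0" if w: "w \<in> ?s - {?z}" for w
  proof
    assume "sin (of_real (pi * T) * w) = 0"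
    then obtain j :: int where j: "w = of_real (of_int j / T)"
      using sin_pi_mult_eq_0_iff[OF T] by blast
    have "dist ?z w = \<bar>of_int k / T - of_int j / T\<bar>"
      unfolding j dist_norm by (metis norm_of_real of_real_diff)
    also have "\<dots> = of_int \<bar>k - j\<bar> / T"
      using T by (simp add: diff_divide_distrib[symmetric])
    finally have "of_int \<bar>k - j\<bar> < (1::real)"
      using w T by (simp add: field_simps)
    then have "k = j" by linarith
    with w j show False by simp
  qed
qed (use assms in \<open>auto intro!: holomorphic_intros holomorphic_on_subset[of G s]\<close>)

lemma cmod_cos_le_cosh: "cmod (cos z) \<le> cosh (Im z)"
proof (rule power2_le_imp_le)
  show "(cmod (cos z))\<^sup>2 \<le> (cosh (Im z))\<^sup>2"
    using sin_cos_squared_add[of "Re z"] zero_le_power2[of "sin (Re z)"]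
    unfolding cmod_cos_squared cosh_square_eq by linarith
qed simp

text \<open>The primitive arctan ((x - t) / b) / b varies by less than pi / b over the whole line.
  That the bound is free of \<open>t\<close> is what makes the final error uniform in x.\<close>

lemma integral_inverse_quadratic_le:
  fixes b t u v :: real
  assumes b: "b > 0" and uv: "u \<le> v"
  shows "integral {u..v} (\<lambda>x. 1 / ((x - t)\<^sup>2 + b\<^sup>2)) \<le> pi / b"
proof -
  have "((\<lambda>x. 1 / ((x - t)\<^sup>2 + b\<^sup>2)) has_integral
      arctan ((v - t) / b) / b - arctan ((u - t) / b) / b) {u..v}"
  proof (rule fundamental_theorem_of_calculus[OF uv])
    fix x assume "x \<in> {u..v}"
    have "((x - t)\<^sup>2 + b\<^sup>2) \<noteq> 0"
      using b by (simp add: sum_power2_eq_zero_iff)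
    then have "((\<lambda>x. arctan ((x - t) / b) / b) has_real_derivative 1 / ((x - t)\<^sup>2 + b\<^sup>2)) (at x within {u..v})"
      using b by (auto intro!: derivative_eq_intros simp: power_divide divide_simps power2_eq_square add_ac)
    then show "((\<lambda>x. arctan ((x - t) / b) / b) has_vector_derivative 1 / ((x - t)\<^sup>2 + b\<^sup>2)) (at x within {u..v})"
      by (simp add: has_real_derivative_iff_has_vector_derivative)
  qed
  then have "integral {u..v} (\<lambda>x. 1 / ((x - t)\<^sup>2 + b\<^sup>2)) = (arctan ((v - t) / b) - arctan ((u - t) / b)) / b"
    by (simp add: integral_unique diff_divide_distrib)
  also have "\<dots> \<le> pi / b"
    using b arctan_ubound[of "(v - t) / b"] arctan_lbound[of "(u - t) / b"]
    by (intro divide_right_mono) auto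
  finally show ?thesis .
qed

text \<open>These are the poles of 1 / sin (pi T z) enclosed by a rectangle of half-width (N + 1/2)
  / T about 0.\<close>

definition sample_points :: "real \<Rightarrow> nat \<Rightarrow> complex set" where
  "sample_points T N = (\<lambda>k::int. of_real (of_int k / T)) ` {- int N..int N}"

lemma finite_sample_points [simp]: "finite (sample_points T N)"
  by (simp add: sample_points_def)

lemma sum_sample_points:
  assumes "T > 0"
  shows "(\<Sum>p\<in>sample_points T N. h p) = (\<Sum>k=- int N..int N. h (of_real (of_int k / T)))"
  unfolding sample_points_def using assms by (subst sum.reindex) (auto simp: inj_on_def)

lemma sample_points_subset:
  assumes "T > 0" "b > 0"
  shows "sample_points T N \<subseteq> {z. \<bar>Re z\<bar> < (of_nat N + 1/2) / T \<and> \<bar>Im z\<bar> < b}"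
proof
  fix z assume "z \<in> sample_points T N"
  then obtain k :: int where k: "- int N \<le> k" "k \<le> int N" "z = of_real (of_int k / T)"
    by (auto simp: sample_points_def)
  then have "\<bar>k\<bar> \<le> int N" by linarith
  then have "of_int \<bar>k\<bar> \<le> (of_int (int N) :: real)" by (simp only: of_int_le_iff)
  then show "z \<in> {z. \<bar>Re z\<bar> < (of_nat N + 1/2) / T \<and> \<bar>Im z\<bar> < b}"
    using assms k by (simp add: divide_strict_right_mono)
qed

text \<open>The 3/4 could be any number strictly between 1/2 and 1: the open rectangle must exceed
  half-width (N + 1/2) / T without reaching the next zero at (N + 1) / T.\<close>

lemma sin_pi_eq_0_imp_sample_point:
  assumes T: "T > 0" and "sin (of_real (pi * T) * z) = 0" and "\<bar>Re z\<bar> < (of_nat N + 3/4) / T"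
  shows "z \<in> sample_points T N"
proof -
  obtain k :: int where k: "z = of_real (of_int k / T)"
    using assms sin_pi_mult_eq_0_iff by blast
  with assms have "of_int \<bar>k\<bar> < real N + 3/4"
    by (simp add: divide_less_cancel)
  then have "\<bar>k\<bar> \<le> int N" by linarith
  then show ?thesis
    unfolding k sample_points_def by (intro imageI) auto
qed

section \<open>Unordered sums over the integers\<close>

lemma int_summable_on_if_bounded_symmetric_sums:
  fixes h :: "int \<Rightarrow> real"
  assumes "\<And>k. 0 \<le> h k" and "\<And>N. (\<Sum>k=- int N..int N. h k) \<le> C"
  shows "h summable_on UNIV"
proof (rule nonneg_bdd_above_summable_on)
  show "bdd_above (sum h ` {A. A \<subseteq> UNIV \<and> finite A})"
  proof (rule bdd_aboveI2)
    fix A :: "int set" assume "A \<in> {A. A \<subseteq> UNIV \<and> finite A}"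
    then have A: "finite A" by simp
    \<comment> \<open>\<open>insert 0\<close> keeps \<open>Max\<close> meaningful when
      \<open>A\<close> is empty.\<close>
    define N where "N = nat (Max (abs ` (insert 0 A)))"
    have "\<bar>k\<bar> \<le> int N" if "k \<in> A" for k
      unfolding N_def using A that by (simp add: le_nat_iff)
    then have "A \<subseteq> {- int N..int N}" by (force simp: abs_le_iff)
    then have "sum h A \<le> (\<Sum>k=- int N..int N. h k)"
      using assms by (intro sum_mono2) auto
    then show "sum h A \<le> C" using assms(2) order_trans by blast
  qed
qed (use assms in auto)

text \<open>Links \<open>infsum\<close>, a limit along all finite sets of integers, to the residue
  sums, which run over symmetric intervals.\<close>

lemma filterlim_symmetric_int_intervals:
  "filterlim (\<lambda>N. {- int N..int N}) (finite_subsets_at_top UNIV) sequentially"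
proof (rule filterlim_finite_subsets_at_top[THEN iffD2], intro allI impI)
  fix A :: "int set" assume "finite A \<and> A \<subseteq> UNIV"
  then have A: "finite A" by simp
  define N where "N = nat (Max (abs ` (insert 0 A)))"
  have N: "\<bar>k\<bar> \<le> int N" if "k \<in> A" for k
    unfolding N_def using A that by (simp add: le_nat_iff)
  show "\<forall>\<^sub>F n in sequentially. finite {- int n..int n} \<and> A \<subseteq> {- int n..int n} \<and> {- int n..int n} \<subseteq> UNIV"
    using eventually_ge_at_top[of N]
  proof eventually_elim
    case (elim n)
    have "k \<in> {- int n..int n}" if "k \<in> A" for k
      using N[OF that] elim by auto
    then show ?case by auto
  qed
qed

lemma nsinc_squared_summable: "(\<lambda>k::int. (nsinc (u - of_int k))\<^sup>2) summable_on UNIV"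
proof (rule summable_on_comparison_test)
  \<comment> \<open>|nsinc v| <= 1 is the useful bound for small v and |nsinc v| <= 1 / (pi |v|) the
    one for large v; adding their squared forms covers both.\<close>
  have sq: "(nsinc v)\<^sup>2 \<le> 2 / (1 + v\<^sup>2)" for v
  proof -
    have "(nsinc v)\<^sup>2 * (pi * v)\<^sup>2 \<le> 1" "(nsinc v)\<^sup>2 \<le> 1"
    proof -
      have "\<bar>sin (pi * v)\<bar> \<le> 1" "\<bar>sin (pi * v)\<bar> \<le> \<bar>pi * v\<bar>"
        by (rule abs_sin_le_one, rule abs_sin_x_le_abs_x)
      then have "(sin (pi * v))\<^sup>2 \<le> 1" "(sin (pi * v))\<^sup>2 \<le> (pi * v)\<^sup>2"
        by (simp_all add: abs_square_le_1 abs_le_square_iff)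
      then show "(nsinc v)\<^sup>2 * (pi * v)\<^sup>2 \<le> 1" "(nsinc v)\<^sup>2 \<le> 1"
        by (auto simp: nsinc_def power_divide)
    qed
    moreover have "(nsinc v)\<^sup>2 * v\<^sup>2 \<le> (nsinc v)\<^sup>2 * (pi * v)\<^sup>2"
    proof (intro mult_left_mono)
      have "1 * v\<^sup>2 \<le> pi\<^sup>2 * v\<^sup>2"
        using pi_gt3 by (intro mult_right_mono) (auto simp: one_le_power)
      then show "v\<^sup>2 \<le> (pi * v)\<^sup>2" by (simp add: power_mult_distrib)
    qed simp
    ultimately have "(nsinc v)\<^sup>2 * (1 + v\<^sup>2) \<le> 2"
      by (simp add: distrib_left)
    then show ?thesis
      by (simp add: pos_le_divide_eq add_pos_nonneg)
  qed
  show "(nsinc (u - of_int k))\<^sup>2 \<le> 4 * (1 + u\<^sup>2) * (1 / (1 + (of_int k)\<^sup>2))" for k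
  proof -
    \<comment> \<open>The shift by u is absorbed into a constant: k^2 <= 2 u^2 + 2 (u - k)^2, the
      difference of the two sides being (2 u - k)^2.\<close>
    let ?k = "of_int k :: real"
    have frac: "2 / A \<le> 2 * D * (1 / B)" if "0 < A" "0 < B" "B \<le> D * A" for A B D :: real
      using that by (simp add: field_simps)
    have "?k\<^sup>2 \<le> 2 * u\<^sup>2 + 2 * (u - ?k)\<^sup>2"
      using zero_le_power2[of "2 * u - ?k"] by (simp add: power2_eq_square algebra_simps)
    moreover have "0 \<le> u\<^sup>2 * (u - ?k)\<^sup>2" by simp
    moreover have "2 * (1 + u\<^sup>2) * (1 + w) = 2 + 2 * u\<^sup>2 + 2 * w + 2 * (u\<^sup>2 * w)" for w
      by (simp add: algebra_simps)
    ultimately have "1 + ?k\<^sup>2 \<le> 2 * (1 + u\<^sup>2) * (1 + (u - ?k)\<^sup>2)"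
      by (smt (verit))
    then have "2 / (1 + (u - ?k)\<^sup>2) \<le> 2 * (2 * (1 + u\<^sup>2)) * (1 / (1 + ?k\<^sup>2))"
      by (intro frac) (simp_all add: add_pos_nonneg)
    also have "\<dots> = 4 * (1 + u\<^sup>2) * (1 / (1 + ?k\<^sup>2))" by simp
    finally have "2 / (1 + (u - ?k)\<^sup>2) \<le> 4 * (1 + u\<^sup>2) * (1 / (1 + ?k\<^sup>2))" .
    then show ?thesis using sq[of "u - ?k"] by linarith
  qed
  show "(\<lambda>k::int. 4 * (1 + u\<^sup>2) * (1 / (1 + (of_int k)\<^sup>2))) summable_on UNIV"
  proof (intro summable_on_cmult_right int_summable_on_if_bounded_symmetric_sums)
    fix N :: nat
    have split: "{- int N..int N} = (\<lambda>n. - int n) ` {1..N} \<union> int ` {0..N}"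
    proof (intro equalityI subsetI)
      fix k assume "k \<in> {- int N..int N}"
      then show "k \<in> (\<lambda>n. - int n) ` {1..N} \<union> int ` {0..N}"
        by (cases k rule: int_cases2) (auto simp: image_iff)
    qed auto
    have "(\<Sum>k=- int N..int N. 1 / (1 + (of_int k)\<^sup>2)) =
        (\<Sum>n=1..N. 1 / (1 + (real n)\<^sup>2)) + (\<Sum>n=0..N. 1 / (1 + (real n)\<^sup>2))"
      unfolding split by (subst sum.union_disjoint) (auto simp: sum.reindex inj_on_def)
    also have "\<dots> \<le> (\<Sum>n. 1 / (1 + (real n)\<^sup>2)) + (\<Sum>n. 1 / (1 + (real n)\<^sup>2))"
    proof -
      have "summable (\<lambda>n. 1 / (1 + (real n)\<^sup>2))"
      proof (rule summable_comparison_test')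
        show "summable (\<lambda>n. 1 / (real n)\<^sup>2)"
          using inverse_power_summable[of 2, where 'a = real] by (simp add: inverse_eq_divide)
        show "norm (1 / (1 + (real n)\<^sup>2)) \<le> 1 / (real n)\<^sup>2" if "n \<ge> 1" for n
          using that by (simp add: frac_le add_pos_nonneg)
      qed
      then show ?thesis by (intro add_mono sum_le_suminf) auto
    qed
    finally show "(\<Sum>k=- int N..int N. 1 / (1 + (of_int k)\<^sup>2)) \<le>
      (\<Sum>n. 1 / (1 + (real n)\<^sup>2)) + (\<Sum>n. 1 / (1 + (real n)\<^sup>2))" .
  qed auto
qed simp

subsection \<open>Cardinal series on a strip\<close>

text \<open>The L2 bound is stated on bounded intervals, where continuity of \<open>F\<close>
  guarantees that the integrals exist; uniformity in \<open>u\<close> and \<open>v\<close> replaces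
  integrability over the whole line. One \<open>M\<close> serves all heights, which permits letting
  the height tend to \<open>a\<close>.\<close>

locale hardy_strip =
  fixes F :: "complex \<Rightarrow> complex" and a M :: real
  assumes a_pos: "0 < a"
    and holo: "F holomorphic_on {z. \<bar>Im z\<bar> < a}"
    and L2: "\<And>u v y. u \<le> v \<Longrightarrow> \<bar>y\<bar> < a \<Longrightarrow> integral {u..v} (\<lambda>x. (cmod (F (Complex x y)))\<^sup>2) \<le> M"
begin

lemma strip_open: "open {z. \<bar>Im z\<bar> < a}"
  by (intro open_Collect_less continuous_intros)

lemma strip_convex: "convex {z. \<bar>Im z\<bar> < a}"
proof -
  have "{z. \<bar>Im z\<bar> < a} = {z. Im z < a} \<inter> {z. Im z > - a}" by auto
  then show ?thesis
    by (simp add: convex_Int convex_halfspace_Im_lt convex_halfspace_Im_gt)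
qed

lemma M_nonneg: "0 \<le> M"
  using L2[of 0 0 0] a_pos by simp

lemma continuous_on_line:
  assumes "\<bar>y\<bar> < a"
  shows "continuous_on A (\<lambda>x. F (Complex x y))"
  using assms holomorphic_on_imp_continuous_on[OF holo]
  by (auto intro!: continuous_on_compose2[of "{z. \<bar>Im z\<bar> < a}" F] continuous_intros simp: Complex_eq)

text \<open>
  The \<open>L\<^sup>2\<close> bound controls the increments over horizontal steps of a primitive of \<open>F\<close>. Since
  these increments are holomorphic, Cauchy's inequality bounds the increments of \<open>F\<close> itself,
  and averaging over the step bounds \<open>F\<close>.
\<close>

lemma bounded_on_substrip:
  assumes "b < a"
  obtains K where "0 \<le> K" "\<And>z. \<bar>Im z\<bar> \<le> b \<Longrightarrow> cmod (F z) \<le> K"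
proof
  \<comment> \<open>Integrating |F| <= (1 + |F|^2) / 2 over a horizontal segment of length at most 1
    gives at most (1 + M) / 2.\<close>
  define K where "K = (1 + M) / 2"
  \<comment> \<open>Half the gap: closed discs of this radius about points with |Im z| <= b stay
    inside the strip.\<close>
  define \<rho> where "\<rho> = (a - b) / 2"
  have \<rho>: "0 < \<rho>" using assms by (simp add: \<rho>_def)
  have K: "0 \<le> K" using M_nonneg by (simp add: K_def)
  show "0 \<le> K / \<rho> + K" using K \<rho> by simp
  obtain \<Phi> where \<Phi>: "\<And>z. \<bar>Im z\<bar> < a \<Longrightarrow> (\<Phi> has_field_derivative F z) (at z)"
    using holomorphic_convex_primitive'[OF strip_convex strip_open holo]
      at_within_open[OF _ strip_open] by (metis mem_Collect_eq)
  have cont: "continuous_on A (\<lambda>s. F (z + of_real s))" if "\<bar>Im z\<bar> < a" for A z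
    using that holomorphic_on_imp_continuous_on[OF holo]
    by (auto intro!: continuous_on_compose2[of "{z. \<bar>Im z\<bar> < a}" F] continuous_intros)
  have avg: "integral {0..\<delta>} (\<lambda>s. cmod (F (z + of_real s))) \<le> K"
    if z: "\<bar>Im z\<bar> < a" and \<delta>: "0 \<le> \<delta>" "\<delta> \<le> 1" for z \<delta>
  proof -
    have eq: "F (z + of_real s) = F (Complex (s + Re z) (Im z))" for s
      by (intro arg_cong[of _ _ F]) (simp add: complex_eq_iff)
    have "integral {0..\<delta>} (\<lambda>s. cmod (F (z + of_real s))) \<le>
        integral {0..\<delta>} (\<lambda>s. (1 + (cmod (F (z + of_real s)))\<^sup>2) / 2)"
    proof (rule integral_le)
      show "cmod (F (z + of_real s)) \<le> (1 + (cmod (F (z + of_real s)))\<^sup>2) / 2" for s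
        using zero_le_power2[of "cmod (F (z + of_real s)) - 1"]
        by (simp add: power2_eq_square algebra_simps)
    qed (intro integrable_continuous_real continuous_intros cont z; simp)+
    also have "\<dots> = (\<delta> + integral {0..\<delta>} (\<lambda>s. (cmod (F (z + of_real s)))\<^sup>2)) / 2"
      using \<delta> by (subst integral_divide, subst integral_add)
        (auto intro!: integrable_continuous_real continuous_intros cont z)
    also have "integral {0..\<delta>} (\<lambda>s. (cmod (F (z + of_real s)))\<^sup>2) =
        integral {Re z..\<delta> + Re z} (\<lambda>x. (cmod (F (Complex x (Im z))))\<^sup>2)"
      unfolding eq
      using integral_shift_Icc_real[of 0 \<delta> "\<lambda>x. (cmod (F (Complex x (Im z))))\<^sup>2" "Re z"]
      by (simp add: o_def add_ac)
    also have "\<dots> \<le> M"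
      using L2[of "Re z" "\<delta> + Re z" "Im z"] \<delta> z by simp
    finally show ?thesis using \<delta> by (simp add: K_def)
  qed
  have incr: "cmod (\<Phi> (z + of_real \<delta>) - \<Phi> z) \<le> K"
    if z: "\<bar>Im z\<bar> < a" and \<delta>: "0 \<le> \<delta>" "\<delta> \<le> 1" for z \<delta>
  proof -
    have "((\<lambda>s. F (z + of_real s)) has_integral (\<Phi> (z + of_real \<delta>) - \<Phi> (z + of_real 0))) {0..\<delta>}"
    proof (rule fundamental_theorem_of_calculus)
      fix s assume "s \<in> {0..\<delta>}"
      have "((\<lambda>s. \<Phi> (z + s)) has_field_derivative F (z + of_real s)) (at (of_real s))"
        using \<Phi>[of "z + of_real s"] z DERIV_shift[of \<Phi> "F (z + of_real s)" "of_real s" z]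
        by (simp add: add.commute)
      then show "((\<lambda>s. \<Phi> (z + of_real s)) has_vector_derivative F (z + of_real s)) (at s within {0..\<delta>})"
        by (rule has_vector_derivative_real_field)
    qed (use \<delta> in auto)
    then have "\<Phi> (z + of_real \<delta>) - \<Phi> z = integral {0..\<delta>} (\<lambda>s. F (z + of_real s))"
      by (simp add: integral_unique)
    then have "cmod (\<Phi> (z + of_real \<delta>) - \<Phi> z) \<le> integral {0..\<delta>} (\<lambda>s. cmod (F (z + of_real s)))"
      by (simp add: integral_norm_bound_integral integrable_continuous_real cont z continuous_intros)
    with avg[OF z \<delta>] show ?thesis by simp
  qed
  fix z assume z: "\<bar>Im z\<bar> \<le> b"
  have za: "\<bar>Im z\<bar> < a" using z assms by simp
  have diff: "cmod (F (z + of_real \<delta>) - F z) \<le> K / \<rho>" if \<delta>: "0 \<le> \<delta>" "\<delta> \<le> 1" for \<delta>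
  proof -
    have near: "\<bar>Im w\<bar> < a" if "dist z w \<le> \<rho>" for w
      using abs_Im_le_cmod[of "z - w"] that z assms by (simp add: dist_norm \<rho>_def)
    define W where "W = (\<lambda>w. \<Phi> (w + of_real \<delta>) - \<Phi> w)"
    have W: "(W has_field_derivative (F (w + of_real \<delta>) - F w)) (at w)" if "\<bar>Im w\<bar> < a" for w
      unfolding W_def
      using \<Phi>[of "w + of_real \<delta>"] \<Phi>[of w] that
      by (intro DERIV_diff) (simp_all add: DERIV_shift)
    have "cmod ((deriv ^^ 1) W z) \<le> fact 1 * K / \<rho> ^ 1"
    proof (rule Cauchy_inequality)
      show "W holomorphic_on ball z \<rho>"
        by (meson W near holomorphic_on_open[OF open_ball] less_imp_le mem_ball)
      show "continuous_on (cball z \<rho>) W"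
        by (meson W near DERIV_isCont continuous_at_imp_continuous_on mem_cball)
      show "cmod (W w) \<le> K" if "cmod (z - w) = \<rho>" for w
        unfolding W_def using that near[of w] \<delta> by (intro incr) (auto simp: dist_norm)
    qed fact
    then show ?thesis using DERIV_imp_deriv[OF W[OF za]] by simp
  qed
  have "cmod (F z) = integral {0..1::real} (\<lambda>s. cmod (F z))" by simp
  also have "\<dots> \<le> integral {0..1} (\<lambda>s. K / \<rho> + cmod (F (z + of_real s)))"
  proof (rule integral_le)
    show "cmod (F z) \<le> K / \<rho> + cmod (F (z + of_real s))" if "s \<in> {0..1}" for s
      using diff[of s] that norm_triangle_ineq2[of "F z" "F (z + of_real s)"]
      by (simp add: norm_minus_commute)
  qed (intro integrable_continuous_real continuous_intros cont za)+
  also have "\<dots> = K / \<rho> + integral {0..1} (\<lambda>s. cmod (F (z + of_real s)))"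
    by (subst integral_add) (auto intro!: integrable_continuous_real continuous_intros cont za)
  also have "\<dots> \<le> K / \<rho> + K" using avg[OF za, of 1] by simp
  finally show "cmod (F z) \<le> K / \<rho> + K" .
qed

lemma square_integrable_interval:
  assumes "\<bar>y\<bar> < a"
  shows "(\<lambda>x. (cmod (F (Complex x y)))\<^sup>2) integrable_on {u..v}"
  using assms by (intro integrable_continuous_real continuous_intros continuous_on_line)

text \<open>
  The product \<open>F z * cnj (F (cnj z))\<close> is holomorphic, equals \<open>\<bar>F\<bar>\<^sup>2\<close> on the real line, and is
  dominated on horizontal lines by an integrable function, so integrating it against
  \<open>cot (\<pi> T z)\<close> along rectangles bounds the partial sums.
\<close>

lemma samples_square_summable:
  assumes T: "T > 0"
  shows "(\<lambda>k::int. (cmod (F (of_real (of_int k / T))))\<^sup>2) summable_on UNIV"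
proof -
  define b where "b = a / 2"
  have b: "0 < b" "b < a" using a_pos by (simp_all add: b_def)
  obtain K where K: "0 \<le> K" "\<And>z. \<bar>Im z\<bar> \<le> b \<Longrightarrow> cmod (F z) \<le> K"
    using bounded_on_substrip[OF b(2)] by blast
  define S where "S = {z. \<bar>Im z\<bar> < a}"
  define s where "s = (\<lambda>z. sin (complex_of_real (pi * T) * z))"
  \<comment> \<open>The cosine cancels the alternating sign of the derivative of the sine. The
    residues of G / s are thus |F|^2 / (pi T) at the sample points, and the modulus of their sum is
    the sum itself.\<close>
  define G where "G = (\<lambda>z. F z * cnj (F (cnj z)) * cos (complex_of_real (pi * T) * z))"
  \<comment> \<open>\<open>C\<close> bounds the cotangent on Im z = b and Im z = -b. The product |F
    z| |F (cnj z)| agrees on the two lines and is at most the mean of the squares, which gives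
    \<open>w\<close>.\<close>
  define C where "C = cosh (pi * T * b) / sinh (pi * T * b)"
  define w where "w = (\<lambda>x. C * (((cmod (F (Complex x b)))\<^sup>2 + (cmod (F (Complex x (-b))))\<^sup>2) / 2))"
  have sinh: "0 < sinh (pi * T * b)" using b T by simp
  have C: "0 \<le> C" using sinh by (simp add: C_def)
  \<comment> \<open>Symmetry of the strip about the real axis makes the reflected function
    \<open>cnj \<circ> F \<circ> cnj\<close> holomorphic on it.\<close>
  have "cnj ` S = S"
    unfolding image_cnj_conv_vimage_cnj by (auto simp: S_def)
  then have "cnj \<circ> F \<circ> cnj holomorphic_on S"
    using holo strip_open by (intro holomorphic_on_compose_cnj_cnj) (simp_all add: S_def)
  then have G: "G holomorphic_on S"
    using holo unfolding G_def S_def o_def by (intro holomorphic_intros) auto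
  have s: "s holomorphic_on A" for A
    unfolding s_def by (intro holomorphic_intros)
  have normG: "cmod (G z) = cmod (F z) * cmod (F (cnj z)) * cmod (cos (complex_of_real (pi * T) * z))" for z
    by (simp add: G_def norm_mult)
  have w: "w integrable_on {u..v}" for u v
    unfolding w_def using b
    by (intro integrable_on_mult_right integrable_on_divide integrable_add square_integrable_interval) auto
  have intw: "integral {u..v} w \<le> C * M" if "u \<le> v" for u v
  proof -
    have "integral {u..v} w = C * ((integral {u..v} (\<lambda>x. (cmod (F (Complex x b)))\<^sup>2) +
        integral {u..v} (\<lambda>x. (cmod (F (Complex x (-b))))\<^sup>2)) / 2)"
      unfolding w_def using b
      by (simp add: integral_add square_integrable_interval)
    also have "\<dots> \<le> C * M"
      using L2[OF that, of b] L2[OF that, of "-b"] b C by (intro mult_left_mono) auto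
    finally show ?thesis .
  qed
  show ?thesis
  proof (rule int_summable_on_if_bounded_symmetric_sums)
    fix N
    define L where "L = (real N + 1/2) / T"
    define L' where "L' = (real N + 3/4) / T"
    have L: "0 < L" "L < L'" using T by (simp_all add: L_def L'_def divide_strict_right_mono)
    have holo': "(\<lambda>z. G z / s z) holomorphic_on {z. \<bar>Re z\<bar> < L' \<and> \<bar>Im z\<bar> < a} - sample_points T N"
      using sin_pi_eq_0_imp_sample_point[OF T, of _ N]
      by (intro holomorphic_on_divide s holomorphic_on_subset[OF G]) (auto simp: S_def s_def L'_def)
    have vert: "cmod (G z / s z) \<le> K\<^sup>2" if z: "\<bar>Re z\<bar> = L" "\<bar>Im z\<bar> \<le> b" for z
    proof -
      note line = half_integer_line[OF T z(1)[unfolded L_def]]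
      have "cmod (F z) * cmod (F (cnj z)) \<le> K * K"
        using K z by (intro mult_mono) auto
      then have "cmod (G z) \<le> K * K * cmod (s z)"
        unfolding normG s_def by (rule mult_mono[OF _ line(2)]) (use K in auto)
      then show ?thesis
        using line(1) by (simp add: norm_divide divide_le_eq power2_eq_square s_def)
    qed
    have hor: "cmod (G (Complex x y) / s (Complex x y)) \<le> w x" if y: "\<bar>y\<bar> = b" for x y
    proof -
      let ?z = "Complex x y"
      have "cmod (F ?z) * cmod (F (cnj ?z)) \<le> ((cmod (F (Complex x b)))\<^sup>2 + (cmod (F (Complex x (-b))))\<^sup>2) / 2"
      proof -
        have "cmod (F ?z) * cmod (F (cnj ?z)) = cmod (F (Complex x b)) * cmod (F (Complex x (-b)))"
          using y by (cases "y = b") (auto simp: abs_if complex_cnj split: if_splits)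
        then show ?thesis
          using zero_le_power2[of "cmod (F (Complex x b)) - cmod (F (Complex x (-b)))"]
          by (simp add: power2_eq_square algebra_simps)
      qed
      moreover have "cmod (cos (complex_of_real (pi * T) * ?z)) / cmod (s ?z) \<le> C"
      proof -
        have im: "\<bar>Im (complex_of_real (pi * T) * ?z)\<bar> = pi * T * b"
          using y T by (simp add: abs_mult)
        have "sinh (pi * T * b) \<le> cmod (s ?z)"
          using sinh_le_cmod_sin[of "complex_of_real (pi * T) * ?z"] im unfolding s_def
          by (metis sinh_real_abs)
        moreover have "cmod (cos (complex_of_real (pi * T) * ?z)) \<le> cosh (pi * T * b)"
          using cmod_cos_le_cosh[of "complex_of_real (pi * T) * ?z"] im
          by (metis cosh_real_abs)
        ultimately show ?thesis
          unfolding C_def using sinh by (intro frac_le) auto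
      qed
      ultimately have "cmod (F ?z) * cmod (F (cnj ?z)) * (cmod (cos (complex_of_real (pi * T) * ?z)) / cmod (s ?z)) \<le>
          ((cmod (F (Complex x b)))\<^sup>2 + (cmod (F (Complex x (-b))))\<^sup>2) / 2 * C"
        by (intro mult_mono) auto
      then show ?thesis
        by (simp add: norm_divide normG w_def mult.commute)
    qed
    have "cmod (\<Sum>p\<in>sample_points T N. residue (\<lambda>z. G z / s z) p) \<le> (integral {-L..L} w + 2 * b * K\<^sup>2) / pi"
      using sample_points_subset[OF T b(1), of N]
      by (intro residue_sum_rectangle_bound[OF b L _ _ _ holo' vert hor w]) (auto simp: L_def)
    also have "\<dots> \<le> (C * M + 2 * b * K\<^sup>2) / pi"
      using intw[of "-L" L] L by (intro divide_right_mono) auto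
    finally have *: "cmod (\<Sum>p\<in>sample_points T N. residue (\<lambda>z. G z / s z) p) \<le> (C * M + 2 * b * K\<^sup>2) / pi" .
    have res: "residue (\<lambda>z. G z / s z) (of_real (of_int k / T)) =
        of_real ((cmod (F (of_real (of_int k / T))))\<^sup>2 / (pi * T))" for k :: int
    proof -
      let ?z = "complex_of_real (of_int k / T)"
      have "residue (\<lambda>z. G z / s z) ?z = G ?z / ((if even k then 1 else -1) * of_real (pi * T))"
        unfolding s_def using a_pos strip_open
        by (intro residue_over_sin_pi[OF T _ _ G]) (auto simp: S_def)
      also have "cos (complex_of_real (pi * T) * ?z) = (if even k then 1 else -1)"
      proof -
        have "complex_of_real (pi * T) * ?z = of_real (pi * of_int k)"
          using T by simp
        then show ?thesis by (simp only: cos_of_real cos_npi_int) simp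
      qed
      then have "G ?z = F ?z * cnj (F ?z) * (if even k then 1 else -1)"
        unfolding G_def complex_cnj_complex_of_real by (rule arg_cong)
      also have "F ?z * cnj (F ?z) = of_real ((cmod (F ?z))\<^sup>2)"
        by (simp only: complex_norm_square)
      finally show ?thesis by simp
    qed
    have "(\<Sum>p\<in>sample_points T N. residue (\<lambda>z. G z / s z) p) =
        of_real ((\<Sum>k=- int N..int N. (cmod (F (of_real (of_int k / T))))\<^sup>2) / (pi * T))"
      by (simp add: sum_sample_points[OF T] res sum_divide_distrib del: of_real_divide)
    moreover have "0 \<le> (\<Sum>k=- int N..int N. (cmod (F (of_real (of_int k / T))))\<^sup>2) / (pi * T)"
      using T by (intro divide_nonneg_nonneg sum_nonneg) auto
    ultimately have "(\<Sum>k=- int N..int N. (cmod (F (of_real (of_int k / T))))\<^sup>2) / (pi * T) \<le> (C * M + 2 * b * K\<^sup>2) / pi"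
      using * by (simp only: norm_of_real abs_of_nonneg)
    then show "(\<Sum>k=- int N..int N. (cmod (F (of_real (of_int k / T))))\<^sup>2) \<le> (C * M + 2 * b * K\<^sup>2) * T"
      using T by (simp add: field_simps)
  qed auto
qed

text \<open>Cauchy-Schwarz: both the samples and the shifted values of \<open>nsinc\<close> are
  square summable.\<close>

lemma sampling_series_summable:
  assumes T: "T > 0"
  shows "(\<lambda>k::int. F (of_real (of_int k / T)) * of_real (nsinc (T * t - of_int k))) summable_on UNIV"
proof (rule Infinite_Sum.abs_summable_summable, rule Infinite_Sum.abs_summable_product)
  show "(\<lambda>k::int. norm (F (of_real (of_int k / T)) * F (of_real (of_int k / T)))) summable_on UNIV"
    using samples_square_summable[OF T] by (simp only: norm_mult power2_eq_square)
  have "norm (complex_of_real r * of_real r) = r\<^sup>2" for r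
    by (simp add: norm_mult power2_eq_square)
  then show "(\<lambda>k::int. norm (complex_of_real (nsinc (T * t - of_int k)) * of_real (nsinc (T * t - of_int k)))) summable_on UNIV"
    using nsinc_squared_summable[of "T * t"] by (simp only:)
qed

text \<open>After multiplication by sin (pi T t), the residue of F z / ((z - t) sin (pi T z)) at t
  becomes F t and those at the sample points become the negated terms of the series. The assumption
  \<open>off\<close> keeps the pole at t simple and apart from the sample points. Only the last
  summand of the bound, from the vertical sides, depends on \<open>N\<close>.\<close>

lemma truncated_sampling_error:
  assumes T: "T > 0" and t: "\<bar>t\<bar> < (real N + 1/2) / T" and off: "sin (pi * T * t) \<noteq> 0"
    and b: "0 < b" "b < a"
    and K: "0 \<le> K" "\<And>z. \<bar>Im z\<bar> \<le> b \<Longrightarrow> cmod (F z) \<le> K"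
  shows "cmod (F (of_real t) - (\<Sum>k=- int N..int N. F (of_real (of_int k / T)) * of_real (nsinc (T * t - of_int k))))
    \<le> ((2 * M + pi / b) / (2 * sinh (pi * T * b)) + 2 * b * (K / ((real N + 1/2) / T - \<bar>t\<bar>))) / pi"
proof -
  define S where "S = {z. \<bar>Im z\<bar> < a}"
  define s where "s = (\<lambda>z. sin (complex_of_real (pi * T) * z))"
  define \<phi> where "\<phi> = (\<lambda>z. F z / (z - of_real t) / s z)"
  define q where "q = sinh (pi * T * b)"
  define L where "L = (real N + 1/2) / T"
  define L' where "L' = (real N + 3/4) / T"
  define P where "P = insert (complex_of_real t) (sample_points T N)"
  have L: "0 < L" "L < L'" using T by (simp_all add: L_def L'_def divide_strict_right_mono)
  have tL: "\<bar>t\<bar> < L" using t by (simp add: L_def)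
  have q: "0 < q" using b T by (simp add: q_def)
  have hs: "s holomorphic_on A" for A
    unfolding s_def by (intro holomorphic_intros)
  have st: "s (of_real t) = of_real (sin (pi * T * t))"
    by (simp add: s_def flip: sin_of_real of_real_mult)
  have tP: "complex_of_real t \<notin> sample_points T N"
  proof
    assume "complex_of_real t \<in> sample_points T N"
    then obtain k :: int where "complex_of_real t = of_real (of_int k / T)"
      unfolding sample_points_def by blast
    then have "t = of_int k / T"
      by (simp only: of_real_eq_iff)
    then show False using off T by simp
  qed
  \<comment> \<open>Adding both lines lets a single majorant serve the upper and the lower side.
    \<open>w\<close> comes from |F| r <= (|F|^2 + r^2) / 2 with r = 1 / |z - t|, divided by the
    lower bound \<open>q\<close> for the sine.\<close>
  define h where "h = (\<lambda>x. (cmod (F (Complex x b)))\<^sup>2 + (cmod (F (Complex x (-b))))\<^sup>2)"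
  define w where "w = (\<lambda>x. (h x + 1 / ((x - t)\<^sup>2 + b\<^sup>2)) / (2 * q))"
  have h: "h integrable_on {u..v}" for u v
    unfolding h_def using b by (intro integrable_add square_integrable_interval) auto
  have r: "(\<lambda>x. 1 / ((x - t)\<^sup>2 + b\<^sup>2)) integrable_on {u..v}" for u v
    using b by (intro integrable_continuous_real continuous_intros) (auto simp: sum_power2_eq_zero_iff)
  have w: "w integrable_on {u..v}" for u v
    unfolding w_def by (intro integrable_on_divide integrable_add h r)
  have intw: "integral {u..v} w \<le> (2 * M + pi / b) / (2 * q)" if "u \<le> v" for u v
  proof -
    have "integral {u..v} h \<le> 2 * M"
      unfolding h_def using L2[OF that, of b] L2[OF that, of "-b"] b
      by (subst integral_add) (auto intro: square_integrable_interval)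
    moreover have "integral {u..v} w = (integral {u..v} h + integral {u..v} (\<lambda>x. 1 / ((x - t)\<^sup>2 + b\<^sup>2))) / (2 * q)"
      unfolding w_def by (simp add: integral_add h r)
    ultimately show ?thesis
      using integral_inverse_quadratic_le[OF b(1) that, of t] q
      by (simp add: divide_right_mono)
  qed
  have holo': "\<phi> holomorphic_on {z. \<bar>Re z\<bar> < L' \<and> \<bar>Im z\<bar> < a} - P"
    unfolding \<phi>_def using sin_pi_eq_0_imp_sample_point[OF T, of _ N]
    by (intro holomorphic_intros hs holomorphic_on_subset[OF holo]) (auto simp: s_def L'_def P_def)
  have vert: "cmod (\<phi> z) \<le> K / (L - \<bar>t\<bar>)" if z: "\<bar>Re z\<bar> = L" "\<bar>Im z\<bar> \<le> b" for z
  proof -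
    have "L - \<bar>t\<bar> \<le> cmod (z - of_real t)"
      using abs_Re_le_cmod[of "z - of_real t"] z by simp
    then have "cmod (F z) / cmod (z - of_real t) \<le> K / (L - \<bar>t\<bar>)"
      using K z tL by (intro frac_le) auto
    moreover have "1 \<le> cmod (s z)"
      using half_integer_line(1)[OF T z(1)[unfolded L_def]] by (simp add: s_def)
    ultimately have "cmod (F z) / cmod (z - of_real t) / cmod (s z) \<le> K / (L - \<bar>t\<bar>) / 1"
      using K(1) tL by (intro frac_le[of "K / (L - \<bar>t\<bar>)" _ 1]) auto
    then show ?thesis
      by (simp only: \<phi>_def norm_divide div_by_1)
  qed
  have hor: "cmod (\<phi> (Complex x y)) \<le> w x" if y: "\<bar>y\<bar> = b" for x y
  proof -
    define r where "r = 1 / cmod (Complex x y - of_real t)"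
    have "y\<^sup>2 = b\<^sup>2" using y by (metis power2_abs)
    then have r2: "r\<^sup>2 = 1 / ((x - t)\<^sup>2 + b\<^sup>2)"
      by (simp add: r_def power_divide cmod_power2)
    have "q \<le> cmod (s (Complex x y))"
      using sinh_le_cmod_sin[of "of_real (pi * T) * Complex x y"] y T unfolding s_def q_def
      by (simp add: abs_mult flip: sinh_real_abs)
    then have "cmod (F (Complex x y)) * r / cmod (s (Complex x y)) \<le> cmod (F (Complex x y)) * r / q"
      using q by (intro divide_left_mono mult_pos_pos order.strict_trans2[OF q]) (auto simp: r_def)
    then have "cmod (\<phi> (Complex x y)) \<le> cmod (F (Complex x y)) * r / q"
      by (simp only: \<phi>_def norm_divide r_def times_divide_eq_right mult_1_right)
    also have "cmod (F (Complex x y)) * r \<le> ((cmod (F (Complex x y)))\<^sup>2 + r\<^sup>2) / 2"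
      using zero_le_power2[of "cmod (F (Complex x y)) - r"]
      by (simp add: power2_eq_square algebra_simps)
    also have "(cmod (F (Complex x y)))\<^sup>2 \<le> h x"
      using y by (cases "y = b") (auto simp: h_def abs_if split: if_splits)
    finally show ?thesis
      using q by (simp add: w_def r2 divide_right_mono)
  qed
  have "cmod (\<Sum>p\<in>P. residue \<phi> p) \<le> (integral {-L..L} w + 2 * b * (K / (L - \<bar>t\<bar>))) / pi"
    using sample_points_subset[OF T b(1), of N] tL K b
    by (intro residue_sum_rectangle_bound[OF b L _ _ _ holo' vert hor w]) (auto simp: L_def P_def)
  also have "\<dots> \<le> ((2 * M + pi / b) / (2 * q) + 2 * b * (K / (L - \<bar>t\<bar>))) / pi"
    using intw[of "-L" L] L by (intro divide_right_mono) auto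
  finally have bound: "cmod (\<Sum>p\<in>P. residue \<phi> p) \<le> \<dots>" .
  have res_t: "residue \<phi> (of_real t) = F (of_real t) / of_real (sin (pi * T * t))"
  proof -
    have "\<phi> = (\<lambda>z. (F z / s z) / (z - of_real t))"
      by (simp add: \<phi>_def fun_eq_iff)
    moreover have "residue (\<lambda>z. (F z / s z) / (z - of_real t)) (of_real t) = F (of_real t) / s (of_real t)"
    proof (rule residue_simple[where s = "S \<inter> s -` (- {0})"])
      show "open (S \<inter> s -` (- {0}))"
        unfolding S_def using hs strip_open
        by (intro continuous_open_preimage holomorphic_on_imp_continuous_on) auto
      show "of_real t \<in> S \<inter> s -` (- {0})"
        using off a_pos by (simp add: S_def st)
      show "(\<lambda>z. F z / s z) holomorphic_on S \<inter> s -` (- {0})"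
        by (intro holomorphic_intros hs holomorphic_on_subset[OF holo]) (auto simp: S_def)
    qed
    ultimately show ?thesis by (simp add: st)
  qed
  have res_k: "of_real (sin (pi * T * t)) * residue \<phi> (of_real (of_int k / T)) =
      - (F (of_real (of_int k / T)) * of_real (nsinc (T * t - of_int k)))"
    if k: "k \<in> {- int N..int N}" for k
  proof -
    define \<epsilon> :: real where "\<epsilon> = (if even k then 1 else -1)"
    let ?z = "complex_of_real (of_int k / T)"
    have ne: "t \<noteq> of_int k / T" using tP k unfolding sample_points_def by blast
    then have ne': "T * t - of_int k \<noteq> 0" using T by (auto simp: field_simps)
    have "residue \<phi> ?z = F ?z / (?z - of_real t) / ((if even k then 1 else -1) * of_real (pi * T))"
      unfolding \<phi>_def s_def
    proof (rule residue_over_sin_pi[OF T, where s = "S - {of_real t}"])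
      show "open (S - {complex_of_real t})"
        unfolding S_def using strip_open by (intro open_Diff) auto
      show "?z \<in> S - {of_real t}"
        using ne a_pos by (simp add: S_def del: of_real_divide)
      show "(\<lambda>z. F z / (z - of_real t)) holomorphic_on S - {of_real t}"
        by (intro holomorphic_intros holomorphic_on_subset[OF holo]) (auto simp: S_def)
    qed
    also have "\<dots> = F ?z * of_real (1 / ((of_int k / T - t) * (\<epsilon> * (pi * T))))"
      by (simp add: \<epsilon>_def)
    also have "(of_int k / T - t) * (\<epsilon> * (pi * T)) = - (\<epsilon> * (pi * (T * t - of_int k)))"
      using T by (simp add: field_simps)
    finally have "of_real (sin (pi * T * t)) * residue \<phi> ?z =
        F ?z * of_real (sin (pi * T * t) * (1 / (- (\<epsilon> * (pi * (T * t - of_int k))))))"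
      by simp
    \<comment> \<open>\<epsilon> = (-1)^k is its own inverse, so the sign from the derivative of the
      sine at k / T cancels the one from shifting the argument by k pi. The minus that remains
      reflects k / T - t against T t - k.\<close>
    moreover have "sin (pi * (T * t - of_int k)) = \<epsilon> * sin (pi * T * t)"
      by (simp add: right_diff_distrib sin_diff \<epsilon>_def mult.assoc)
    then have "nsinc (T * t - of_int k) = - (sin (pi * T * t) * (1 / (- (\<epsilon> * (pi * (T * t - of_int k))))))"
      using ne' by (simp add: nsinc_def \<epsilon>_def)
    ultimately show ?thesis by (simp only: of_real_minus mult_minus_right minus_minus)
  qed
  have "of_real (sin (pi * T * t)) * (\<Sum>p\<in>P. residue \<phi> p) =
      F (of_real t) - (\<Sum>k=- int N..int N. F (of_real (of_int k / T)) * of_real (nsinc (T * t - of_int k)))"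
  proof -
    have "of_real (sin (pi * T * t)) * (\<Sum>p\<in>P. residue \<phi> p) = of_real (sin (pi * T * t)) * residue \<phi> (of_real t) +
        (\<Sum>k=- int N..int N. of_real (sin (pi * T * t)) * residue \<phi> (of_real (of_int k / T)))"
      unfolding P_def using tP
      by (simp add: sum_sample_points[OF T] distrib_left sum_distrib_left del: of_real_divide)
    also have "(\<Sum>k=- int N..int N. of_real (sin (pi * T * t)) * residue \<phi> (of_real (of_int k / T))) =
        (\<Sum>k=- int N..int N. - (F (of_real (of_int k / T)) * of_real (nsinc (T * t - of_int k))))"
      by (intro sum.cong refl res_k)
    finally show ?thesis
      using off by (simp add: res_t sum_negf del: of_real_divide)
  qed
  then have "cmod (F (of_real t) - (\<Sum>k=- int N..int N. F (of_real (of_int k / T)) * of_real (nsinc (T * t - of_int k))))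
      = \<bar>sin (pi * T * t)\<bar> * cmod (\<Sum>p\<in>P. residue \<phi> p)"
    by (metis norm_mult norm_of_real)
  also have "\<dots> \<le> 1 * cmod (\<Sum>p\<in>P. residue \<phi> p)"
    by (intro mult_right_mono) auto
  finally show ?thesis
    using bound unfolding q_def L_def by simp
qed

lemma sampling_error:
  assumes T: "T > 0"
  shows "cmod (F (of_real t) - (\<Sum>\<^sub>\<infinity>k::int. F (of_real (of_int k / T)) * of_real (nsinc (T * t - of_int k))))
    \<le> (2 * M + pi / a) / (2 * pi * sinh (pi * T * a))"
proof (cases "sin (pi * T * t) = 0")
  case True
  then have "sin (T * t * pi) = 0" by (simp add: mult_ac)
  then obtain j :: int where j: "T * t = of_int j"
    unfolding sin_times_pi_eq_0 by (auto elim: Ints_cases)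
  have tj: "of_int j / T = t" using j T by (simp add: field_simps)
  \<comment> \<open>At a sample point every other term has the sine of a multiple of pi in its
    numerator, so the series collapses to F t and the error is 0.\<close>
  have nsinc: "nsinc (T * t - of_int k) = (if k = j then 1 else 0)" for k
  proof -
    have "sin (pi * of_int (j - k)) = 0" by (rule sin_npi_int)
    then show ?thesis unfolding j nsinc_def by simp
  qed
  have "(\<Sum>\<^sub>\<infinity>k::int. F (of_real (of_int k / T)) * of_real (nsinc (T * t - of_int k))) =
      (\<Sum>\<^sub>\<infinity>k\<in>{j}. F (of_real (of_int k / T)) * of_real (nsinc (T * t - of_int k)))"
    by (rule infsum_cong_neutral) (auto simp: nsinc)
  also have "\<dots> = F (of_real t)"
    using j T by (simp add: nsinc tj nsinc_def del: of_real_divide)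
  finally show ?thesis
    using a_pos T M_nonneg by simp
next
  case off: False
  define E where "E = cmod (F (of_real t) - (\<Sum>\<^sub>\<infinity>k::int. F (of_real (of_int k / T)) * of_real (nsinc (T * t - of_int k))))"
  \<comment> \<open>The limit in \<open>N\<close> is taken at fixed b. \<open>K\<close> may blow up
    as b tends to a, but its term has vanished by then, and what is left is continuous in b at
    a.\<close>
  have E: "E \<le> (2 * M + pi / b) / (2 * sinh (pi * T * b)) / pi" if b: "0 < b" "b < a" for b
  proof -
    obtain K where K: "0 \<le> K" "\<And>z. \<bar>Im z\<bar> \<le> b \<Longrightarrow> cmod (F z) \<le> K"
      using bounded_on_substrip[OF b(2)] by blast
    have lim1: "((\<lambda>N. cmod (F (of_real t) - (\<Sum>k=- int N..int N. F (of_real (of_int k / T)) * of_real (nsinc (T * t - of_int k))))) \<longlongrightarrow> E) sequentially"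
      unfolding E_def
      by (intro tendsto_intros filterlim_compose[OF infsum_tendsto filterlim_symmetric_int_intervals]
            sampling_series_summable[OF T])
    have "filterlim (\<lambda>N. (1 / (2 * T) - \<bar>t\<bar>) + 1 / T * real N) at_top sequentially"
      using T by (intro filterlim_tendsto_add_at_top[OF tendsto_const]
        filterlim_tendsto_pos_mult_at_top[OF tendsto_const _ filterlim_real_sequentially]) simp
    then have L: "filterlim (\<lambda>N. (real N + 1/2) / T - \<bar>t\<bar>) at_top sequentially"
      by (simp add: add_divide_distrib algebra_simps)
    have lim2: "((\<lambda>N. ((2 * M + pi / b) / (2 * sinh (pi * T * b)) +
        2 * b * (K / ((real N + 1/2) / T - \<bar>t\<bar>))) / pi) \<longlongrightarrow>
        ((2 * M + pi / b) / (2 * sinh (pi * T * b)) + 2 * b * 0) / pi) sequentially"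
      by (intro tendsto_intros tendsto_divide_0[OF tendsto_const] filterlim_at_top_imp_at_infinity L) auto
    have "eventually (\<lambda>N. 0 < (real N + 1/2) / T - \<bar>t\<bar>) sequentially"
      using L unfolding filterlim_at_top_dense by blast
    then have "eventually (\<lambda>N. cmod (F (of_real t) - (\<Sum>k=- int N..int N. F (of_real (of_int k / T)) * of_real (nsinc (T * t - of_int k))))
        \<le> ((2 * M + pi / b) / (2 * sinh (pi * T * b)) + 2 * b * (K / ((real N + 1/2) / T - \<bar>t\<bar>))) / pi) sequentially"
      by eventually_elim (intro truncated_sampling_error[OF T _ off b K]; simp)
    from tendsto_le[OF _ lim2 lim1 this] show ?thesis by simp
  qed
  have "((\<lambda>b. (2 * M + pi / b) / (2 * sinh (pi * T * b)) / pi) \<longlongrightarrow>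
      (2 * M + pi / a) / (2 * sinh (pi * T * a)) / pi) (at_left a)"
    using a_pos T by (intro tendsto_intros) auto
  moreover have "eventually (\<lambda>b. E \<le> (2 * M + pi / b) / (2 * sinh (pi * T * b)) / pi) (at_left a)"
    using eventually_at_left_real[OF a_pos] by eventually_elim (rule E; simp)
  ultimately have "E \<le> (2 * M + pi / a) / (2 * sinh (pi * T * a)) / pi"
    by (rule tendsto_lowerbound) simp
  then show ?thesis
    by (simp add: E_def mult_ac)
qed

end

subsection \<open>Mellin--Hardy functions in logarithmic coordinates\<close>

text \<open>The map (exp (Re z), Im z) is a bijection of the complex plane onto
  \<open>polar_halfplane\<close>; in this chart the projection \<open>polar_point\<close> is the
  exponential.\<close>

lemma polar_point_exp: "polar_point (exp (Re z), Im z) = exp z"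
  using exp_eq_polar[of z] by (simp only: polar_point_def fst_conv snd_conv cis_conv_exp)

text \<open>Pulled back to the chart, the polar difference quotient has denominator exp z - exp z0.
  Multiplied by the difference quotient of exp it becomes the ordinary one, so the derivative is
  \<open>l * exp z0\<close>.\<close>

lemma polar_analytic_imp_holomorphic:
  assumes "f polar_analytic_on polar_strip a"
  shows "(\<lambda>z. f (exp (Re z), Im z)) holomorphic_on {z. \<bar>Im z\<bar> < a}"
proof (rule holomorphic_onI, goal_cases)
  case (1 z0)
  let ?S = "{z::complex. \<bar>Im z\<bar> < a}"
  define p where "p = (\<lambda>z. (exp (Re z), Im z))"
  have p_strip: "p z \<in> polar_strip a" if "z \<in> ?S" for z
    using that by (auto simp: p_def polar_strip_def polar_halfplane_def)
  have point: "polar_point (p z) = exp z" for z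
    by (simp add: p_def polar_point_exp)
  obtain l where l: "((\<lambda>q. (f q - f (p z0)) / (polar_point q - polar_point (p z0))) \<longlongrightarrow> l) (at (p z0) within polar_strip a)"
    using assms p_strip[OF 1] unfolding polar_analytic_on_def by blast
  \<comment> \<open>Injectivity of \<open>p\<close> sends punctured neighbourhoods to punctured
    neighbourhoods.\<close>
  have "filterlim p (at (p z0) within polar_strip a) (at z0 within ?S)"
    unfolding filterlim_at
  proof
    show "(p \<longlongrightarrow> p z0) (at z0 within ?S)"
      unfolding p_def by (intro tendsto_intros)
    show "\<forall>\<^sub>F z in at z0 within ?S. p z \<in> polar_strip a \<and> p z \<noteq> p z0"
      using p_strip by (auto simp: eventually_at_filter p_def complex_eq_iff)
  qed
  from filterlim_compose[OF l this]
  have quot: "((\<lambda>z. (f (p z) - f (p z0)) / (exp z - exp z0)) \<longlongrightarrow> l) (at z0 within ?S)"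
    by (simp add: point)
  \<comment> \<open>Besides giving the second factor, this limit is nonzero, so exp z differs from
    exp z0 near z0. The cancellation below depends on that, since exp is not injective and division
    by zero yields 0.\<close>
  have exp: "((\<lambda>z. (exp z - exp z0) / (z - z0)) \<longlongrightarrow> exp z0) (at z0 within ?S)"
    using DERIV_exp[THEN has_field_derivative_at_within] by (simp add: has_field_derivative_iff)
  have "\<forall>\<^sub>F z in at z0 within ?S. (exp z - exp z0) / (z - z0) \<noteq> 0"
    by (rule tendsto_imp_eventually_ne[OF exp]) simp
  then have "\<forall>\<^sub>F z in at z0 within ?S. (f (p z) - f (p z0)) / (exp z - exp z0) * ((exp z - exp z0) / (z - z0)) =
      (f (p z) - f (p z0)) / (z - z0)"
    by eventually_elim auto
  then have "((\<lambda>z. (f (p z) - f (p z0)) / (z - z0)) \<longlongrightarrow> l * exp z0) (at z0 within ?S)"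
    using tendsto_mult[OF quot exp] by (rule Lim_transform_eventually[rotated])
  then show ?case
    unfolding p_def field_differentiable_def has_field_derivative_iff by blast
qed

text \<open>Passes from the Lebesgue integral in \<open>X2_norm\<close> to the gauge integral, in
  which the substitution and the bound of \<open>hardy_strip\<close> are phrased.\<close>

lemma X2_norm_squared:
  assumes "\<phi> \<in> X2_space c"
  shows "(X2_norm c \<phi>)\<^sup>2 = integral {0<..} (\<lambda>r. (cmod (\<phi> r))\<^sup>2 * r powr (2 * c - 1))"
    and "(\<lambda>r. (cmod (\<phi> r))\<^sup>2 * r powr (2 * c - 1)) integrable_on {0<..}"
proof -
  have int: "integrable (lebesgue_on {0<..}) (\<lambda>r. (cmod (\<phi> r))\<^sup>2 * r powr (2 * c - 1))"
    using assms by (simp add: X2_space_def)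
  then show "(\<lambda>r. (cmod (\<phi> r))\<^sup>2 * r powr (2 * c - 1)) integrable_on {0<..}"
    by (intro integrable_on_lebesgue_on) auto
  have "0 \<le> (LINT r|lebesgue_on {0<..}. (cmod (\<phi> r))\<^sup>2 * r powr (2 * c - 1))"
    by (rule integral_nonneg_AE) auto
  then show "(X2_norm c \<phi>)\<^sup>2 = integral {0<..} (\<lambda>r. (cmod (\<phi> r))\<^sup>2 * r powr (2 * c - 1))"
    unfolding X2_norm_def using int by (simp add: lebesgue_integral_eq_integral)
qed

text \<open>With r = exp x, the measure r powr (2 c - 1) dr becomes exp (2 c x) dx, which is the
  origin of the factor exp (c z) in \<open>F\<close>. The substitution is made on a compact
  interval, and extending a nonnegative integrand to the half-line only increases its
  integral.\<close>

lemma integral_exp_substitution_le_X2_norm: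
  assumes \<phi>: "\<phi> \<in> X2_space c" and cont: "continuous_on {0<..} \<phi>" and uv: "u \<le> v"
  shows "integral {u..v} (\<lambda>x. (exp (c * x) * cmod (\<phi> (exp x)))\<^sup>2) \<le> (X2_norm c \<phi>)\<^sup>2"
proof -
  let ?h = "\<lambda>r. (cmod (\<phi> r))\<^sup>2 * r powr (2 * c - 1)"
  have sub: "{exp u..exp v} \<subseteq> {0<..}"
    by (auto intro: less_le_trans[OF exp_gt_zero])
  have "continuous_on {0<..} ?h"
    by (intro continuous_intros cont) auto
  then have h: "continuous_on {exp u..exp v} ?h"
    using sub continuous_on_subset by blast
  have "((\<lambda>x. exp x *\<^sub>R ?h (exp x)) has_integral integral {exp u..exp v} ?h) {u..v}"
    using uv h by (intro has_integral_substitution) (auto intro!: derivative_eq_intros)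
  moreover have "exp x *\<^sub>R ?h (exp x) = (exp (c * x) * cmod (\<phi> (exp x)))\<^sup>2" for x
  proof -
    have "exp x * exp x powr (2 * c - 1) = (exp (c * x))\<^sup>2"
      by (simp add: powr_def power2_eq_square algebra_simps flip: exp_add)
    then show ?thesis by (simp add: power_mult_distrib mult_ac)
  qed
  ultimately have "integral {u..v} (\<lambda>x. (exp (c * x) * cmod (\<phi> (exp x)))\<^sup>2) = integral {exp u..exp v} ?h"
    by (simp add: integral_unique)
  also have "\<dots> \<le> integral {0<..} ?h"
    using h X2_norm_squared(2)[OF \<phi>] sub
    by (intro integral_subset_le integrable_continuous_real) auto
  finally show ?thesis
    by (simp add: X2_norm_squared(1)[OF \<phi>])
qed

lemma mellin_hardy2_imp_hardy_strip:
  assumes a: "a > 0" and f: "f \<in> mellin_hardy2 c a"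
  obtains M where "hardy_strip (\<lambda>z. exp (of_real c * z) * f (exp (Re z), Im z)) a M"
proof -
  let ?X = "\<lambda>\<theta>. (X2_norm c (\<lambda>r. f (r, \<theta>)))\<^sup>2"
  have pa: "f polar_analytic_on polar_strip a"
    and X2: "\<And>\<theta>. \<bar>\<theta>\<bar> < a \<Longrightarrow> (\<lambda>r. f (r, \<theta>)) \<in> X2_space c"
    and bdd: "bdd_above ((\<lambda>\<theta>. sqrt ((?X \<theta> + ?X (- \<theta>)) / 2)) ` {0<..<a})"
    using f by (auto simp: mellin_hardy2_def abs_less_iff)
  from bdd obtain B where B: "\<And>\<theta>. 0 < \<theta> \<Longrightarrow> \<theta> < a \<Longrightarrow> sqrt ((?X \<theta> + ?X (- \<theta>)) / 2) \<le> B"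
    unfolding bdd_above_def by (meson greaterThanLessThan_iff imageI)
  \<comment> \<open>The Hardy condition bounds the mean of the squared norms at \<theta> and
    -\<theta>, so each is at most twice the bound. Its supremum leaves out \<theta> = 0, whose norm
    is finite by itself and enters through \<open>max\<close>.\<close>
  define M where "M = max (2 * B\<^sup>2) (?X 0)"
  have pos: "?X \<theta> \<le> 2 * B\<^sup>2 \<and> ?X (- \<theta>) \<le> 2 * B\<^sup>2" if "0 < \<theta>" "\<theta> < a" for \<theta>
  proof -
    have "A \<le> 2 * D \<and> A' \<le> 2 * D" if "(A + A') / 2 \<le> D" "0 \<le> A" "0 \<le> A'" for A A' D :: real
      using that by auto
    from this[OF sqrt_le_D[OF B[OF that]] zero_le_power2 zero_le_power2] show ?thesis .
  qed
  have M: "?X \<theta> \<le> M" if "\<bar>\<theta>\<bar> < a" for \<theta>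
    using pos[of \<theta>] pos[of "- \<theta>"] that
    by (cases \<theta> "0 :: real" rule: linorder_cases) (auto simp: M_def le_max_iff_disj)
  have holo: "(\<lambda>z. f (exp (Re z), Im z)) holomorphic_on {z. \<bar>Im z\<bar> < a}"
    using pa by (rule polar_analytic_imp_holomorphic)
  have "hardy_strip (\<lambda>z. exp (of_real c * z) * f (exp (Re z), Im z)) a M"
  proof
    show "(\<lambda>z. exp (of_real c * z) * f (exp (Re z), Im z)) holomorphic_on {z. \<bar>Im z\<bar> < a}"
      by (intro holomorphic_intros holo)
    fix u v y :: real assume uv: "u \<le> v" and y: "\<bar>y\<bar> < a"
    have "continuous_on {0<..} (\<lambda>r. f (exp (Re (Complex (ln r) y)), Im (Complex (ln r) y)))"
      unfolding Complex_eq
      by (rule continuous_on_compose2[OF holomorphic_on_imp_continuous_on[OF holo]])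
         (use y in \<open>auto intro!: continuous_intros\<close>)
    then have "continuous_on {0<..} (\<lambda>r. f (r, y))"
      by (rule continuous_on_eq) auto
    from integral_exp_substitution_le_X2_norm[OF X2[OF y] this uv]
    have "integral {u..v} (\<lambda>x. (exp (c * x) * cmod (f (exp x, y)))\<^sup>2) \<le> M"
      using M[OF y] by linarith
    then show "integral {u..v} (\<lambda>x. (cmod (exp (of_real c * Complex x y) *
        f (exp (Re (Complex x y)), Im (Complex x y))))\<^sup>2) \<le> M"
      by (simp add: norm_mult)
  qed fact
  then show ?thesis by (rule that)
qed

text \<open>The index c / T is chosen so that the weights match: (exp (-k) x^T)^(-c/T) = x^(-c) exp
  (c k / T). The first factor cancels x^c and the second turns f into \<open>F\<close> at k /
  T.\<close>

lemma exp_sampling_remainder_eq: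
  fixes f :: "real \<times> real \<Rightarrow> complex" and c :: real
  defines "F \<equiv> \<lambda>z. exp (of_real c * z) * f (exp (Re z), Im z)"
  assumes T: "T > 0" and x: "x > 0"
  shows "of_real (x powr c) * exp_sampling_remainder c T (\<lambda>r. f (r, 0)) x =
    F (of_real (ln x)) - (\<Sum>\<^sub>\<infinity>k::int. F (of_real (of_int k / T)) * of_real (nsinc (T * ln x - of_int k)))"
proof -
  have F: "F (of_real t) = of_real (exp (c * t)) * f (exp t, 0)" for t
    by (simp add: F_def exp_of_real flip: of_real_mult)
  have summand: "of_real (x powr c) * (f (exp (of_int k / T), 0) * of_real (lin (c / T) (exp (- of_int k) * x powr T))) =
      F (of_real (of_int k / T)) * of_real (nsinc (T * ln x - of_int k))" for k :: int
  proof -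
    have ln: "ln (exp (- of_int k) * x powr T) = T * ln x - of_int k"
      using x by (simp add: ln_mult)
    have "(exp (- of_int k) * x powr T) powr (- (c / T)) = exp (- (c / T) * (T * ln x - of_int k))"
      using x by (simp only: powr_def[of "exp (- of_int k) * x powr T"] ln) simp
    moreover have "exp (c * ln x) * exp (- (c / T) * (T * ln x - of_int k)) = exp (c * (of_int k / T))"
      using T by (simp add: field_simps flip: exp_add)
    ultimately have "x powr c * lin (c / T) (exp (- of_int k) * x powr T) =
        exp (c * (of_int k / T)) * nsinc (T * ln x - of_int k)"
      using x by (simp only: lin_def ln mult.assoc [symmetric]) (simp add: powr_def)
    then have "complex_of_real (x powr c) * of_real (lin (c / T) (exp (- of_int k) * x powr T)) =
        of_real (exp (c * (of_int k / T))) * of_real (nsinc (T * ln x - of_int k))"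
      by (simp only: of_real_mult [symmetric])
    moreover have "A * (g * B) = C * g * D" if "A * B = C * D" for A B C D g :: complex
      using that by algebra
    ultimately show ?thesis unfolding F by blast
  qed
  have "of_real (x powr c) * exp_sampling_series c T (\<lambda>r. f (r, 0)) x =
      (\<Sum>\<^sub>\<infinity>k::int. F (of_real (of_int k / T)) * of_real (nsinc (T * ln x - of_int k)))"
    unfolding exp_sampling_series_def summand [symmetric] by (rule infsum_cmult_right' [symmetric])
  moreover have "of_real (x powr c) * f (x, 0) = F (of_real (ln x))"
    using x by (simp add: F powr_def)
  ultimately show ?thesis
    by (simp add: exp_sampling_remainder_def right_diff_distrib)
qed

lemma exp_le_sinh:
  fixes s :: real
  assumes "1 \<le> s"
  shows "exp s \<le> 4 * sinh s"
proof -
  \<comment> \<open>4 sinh s = 2 exp s - 2 exp (-s), so the claim amounts to 2 exp (-s) <= exp s;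
    for s >= 1 the number 2 separates the two sides.\<close>
  have "2 * exp (- s) \<le> 2 * 1" using assms by (intro mult_left_mono) auto
  also have "\<dots> \<le> exp s" using exp_ge_add_one_self[of s] assms by linarith
  finally show ?thesis by (simp add: sinh_field_def)
qed

text \<open>\<open>enn2real\<close> sends infinity to 0, so the growth statement alone would hold
  for an infinite norm; eventual finiteness is therefore part of the claim.\<close>

theorem corollary1:
  fixes c a :: real and f :: "real \<times> real \<Rightarrow> complex"
  assumes "a > 0"
    and "f \<in> mellin_hardy2 c a"
  shows "(\<forall>\<^sub>F T in at_top. Xinf_norm c (exp_sampling_remainder c T (\<lambda>r. f (r, 0))) < \<infinity>) \<and>
    (\<lambda>T. enn2real (Xinf_norm c (exp_sampling_remainder c T (\<lambda>r. f (r, 0)))))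
      \<in> O[at_top](\<lambda>T. exp (- a * pi * T))"
proof -
  obtain M where strip: "hardy_strip (\<lambda>z. exp (of_real c * z) * f (exp (Re z), Im z)) a M"
    using mellin_hardy2_imp_hardy_strip[OF assms] .
  define C where "C = (2 * M + pi / a) / (2 * pi)"
  have C: "0 \<le> C"
    using hardy_strip.M_nonneg[OF strip] assms(1) by (simp add: C_def)
  have bound: "Xinf_norm c (exp_sampling_remainder c T (\<lambda>r. f (r, 0))) \<le> ennreal (C / sinh (pi * T * a))"
    if T: "T > 0" for T
    unfolding Xinf_norm_def
  proof (rule SUP_least, rule ennreal_leI)
    fix x :: real assume "x \<in> {0<..}"
    then have x: "x > 0" by simp
    have "x powr c * cmod (exp_sampling_remainder c T (\<lambda>r. f (r, 0)) x) =
        cmod (of_real (x powr c) * exp_sampling_remainder c T (\<lambda>r. f (r, 0)) x)"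
      by (simp add: norm_mult)
    also have "\<dots> \<le> C / sinh (pi * T * a)"
      unfolding exp_sampling_remainder_eq[OF T x] C_def
      using hardy_strip.sampling_error[OF strip T, of "ln x"] by simp
    finally show "x powr c * cmod (exp_sampling_remainder c T (\<lambda>r. f (r, 0)) x) \<le> C / sinh (pi * T * a)" .
  qed
  show ?thesis
  proof
    show "\<forall>\<^sub>F T in at_top. Xinf_norm c (exp_sampling_remainder c T (\<lambda>r. f (r, 0))) < \<infinity>"
      using eventually_gt_at_top[of 0]
      by eventually_elim (auto intro: le_less_trans[OF bound])
    show "(\<lambda>T. enn2real (Xinf_norm c (exp_sampling_remainder c T (\<lambda>r. f (r, 0)))))
      \<in> O[at_top](\<lambda>T. exp (- a * pi * T))"
    proof (rule bigoI)
      show "\<forall>\<^sub>F T in at_top. norm (enn2real (Xinf_norm c (exp_sampling_remainder c T (\<lambda>r. f (r, 0)))))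
          \<le> 4 * C * norm (exp (- a * pi * T))"
        \<comment> \<open>From this threshold on pi T a >= 1, as \<open>exp_le_sinh\<close>
          requires; its constant is the 4 in \<open>4 * C\<close>.\<close>
        using eventually_ge_at_top[of "1 / (pi * a)"]
      proof eventually_elim
        case (elim T)
        have T: "0 < T"
          using elim assms(1) by (intro less_le_trans[OF _ elim]) simp
        have "1 \<le> pi * T * a"
          using elim assms(1) by (simp add: field_simps)
        then have "exp (pi * T * a) / 4 \<le> sinh (pi * T * a)"
          using exp_le_sinh[of "pi * T * a"] by linarith
        then have "C / sinh (pi * T * a) \<le> C / (exp (pi * T * a) / 4)"
          using C by (intro divide_left_mono mult_pos_pos) (auto simp: T assms(1))
        also have "\<dots> = 4 * C * exp (- a * pi * T)"
          by (simp add: exp_minus field_simps)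
        finally have "C / sinh (pi * T * a) \<le> 4 * C * exp (- a * pi * T)" .
        moreover have "enn2real (Xinf_norm c (exp_sampling_remainder c T (\<lambda>r. f (r, 0)))) \<le> C / sinh (pi * T * a)"
          using bound[OF T] C T assms(1) by (intro enn2real_leI) auto
        ultimately show ?case by simp
      qed
    qed
  qed
qed

end
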